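(* For each fixed integer $k\ge2$, the site specific strip approximation entropies $h_n^{(k)}$ converge, as $n\to\infty$, to the entropy $h^{(k)}$ of the golden mean shift of finite type on the $k$-tree: $$\lim_{n\to\infty}h_n^{(k)}=h^{(k)}.$$
   Context: Fix an integer $k\ge2$. The $k$-tree is the set $\Sigma_k^*$ of finite words on $\{0,\dots,k-1\}$, with root the empty word, in which the children of $w$ are the nodes $ws$. Let $\Delta_n$ be the set of words of length at most $n$ ($\Delta_{-1}=\emptyset$), so $|\Delta_n|=1+k+\dots+k^n$. A labeling of a subset of nodes by $\{0,1\}$ is legal if no two adjacent nodes (parent and child) are both labeled $1$; the golden mean shift of finite type on the $k$-tree is the set of all legal labelings of the $k$-tree. Let $B_n$ be the number of legal labelings of $\Delta_n$. The entropy is $h^{(k)}=\lim_{n\to\infty}\log B_n/|\Delta_n|$. Strips: for $n\ge0$, $\Sigma_n^{(k)}$ is the one-dimensional shift of finite type formed by the legal labelings of the strip consisting of the left edge $\{0^i:i\ge0\}$ of the tree together with, at each node $0^i$, the $k-1$ translates of $\Delta_{n-1}$ rooted at its children $0^is$, $s\ne0$. Its alphabet is the set of legal labelings of the tree with $k^n$ nodes consisting of a vertex with $k-1$ copies of $\Delta_{n-1}$ attached below it, and two symbols may be consecutive iff their top vertices are not both labeled $1$. The site specific strip entropy is $h_n^{(k)}=h(\Sigma_n^{(k)})/k^n$, where $h(\Sigma_n^{(k)})$ is the topological entropy of $\Sigma_n^{(k)}$. *)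

theory Defs
  imports Complex_Main "HOL-Library.FuncSet"
begin

definition tree :: "nat \<Rightarrow> nat list set" where
  "tree k = lists {..<k}"

text \<open>The bound is an integer so that \<open>Delta k (- 1)\<close> is the empty set.\<close>

definition Delta :: "nat \<Rightarrow> int \<Rightarrow> nat list set" where
  "Delta k n = {w \<in> tree k. int (length w) \<le> n}"

text \<open>Labelings of \<open>S\<close> are extensional functions, so that each one is counted once.\<close>

definition legal_labelings :: "nat list set \<Rightarrow> (nat list \<Rightarrow> nat) set" where
  "legal_labelings S =
     {x \<in> S \<rightarrow>\<^sub>E {0, 1}. \<forall>w s. w \<in> S \<and> w @ [s] \<in> S \<longrightarrow> \<not> (x w = 1 \<and> x (w @ [s]) = 1)}"

definition tree_entropy :: "nat \<Rightarrow> real" where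
  "tree_entropy k =
     lim (\<lambda>n. ln (real (card (legal_labelings (Delta k (int n))))) / real (card (Delta k (int n))))"

definition blocks :: "(nat \<Rightarrow> 'a) set \<Rightarrow> nat \<Rightarrow> 'a list set" where
  "blocks X m = {map x [i..<i + m] | x i. x \<in> X}"

definition topological_entropy :: "(nat \<Rightarrow> 'a) set \<Rightarrow> real" where
  "topological_entropy X = lim (\<lambda>m. ln (real (card (blocks X m))) / real m)"

definition strip_cell :: "nat \<Rightarrow> nat \<Rightarrow> nat list set" where
  "strip_cell k n = insert [] {s # w | s w. s \<in> {1..<k} \<and> w \<in> Delta k (int n - 1)}"

definition strip_shift :: "nat \<Rightarrow> nat \<Rightarrow> (nat \<Rightarrow> nat list \<Rightarrow> nat) set" where
  "strip_shift k n =
     {x. (\<forall>i. x i \<in> legal_labelings (strip_cell k n)) \<and>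
         (\<forall>i. \<not> (x i [] = 1 \<and> x (Suc i) [] = 1))}"

text \<open>The strip itself; \<open>strip_shift_eq_labelings\<close> says that \<open>strip_shift\<close> consists of its legal
  labelings, read off cell by cell down the left edge.\<close>

definition strip :: "nat \<Rightarrow> nat \<Rightarrow> nat list set" where
  "strip k n = {replicate i 0 @ v | i v. v \<in> strip_cell k n}"

lemma takeWhile_dropWhile_edge:
  "takeWhile (\<lambda>a. a = 0) (replicate i (0::nat) @ v) = replicate i 0 @ takeWhile (\<lambda>a. a = 0) v"
  "dropWhile (\<lambda>a. a = 0) (replicate i (0::nat) @ v) = dropWhile (\<lambda>a. a = 0) v"
  by (induction i) simp_all

lemma strip_decomp:
  assumes "v \<in> strip_cell k n"
  shows "takeWhile (\<lambda>a. a = 0) (replicate i 0 @ v) = replicate i 0"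
    and "dropWhile (\<lambda>a. a = 0) (replicate i 0 @ v) = v"
proof -
  have "takeWhile (\<lambda>a. a = 0) v = [] \<and> dropWhile (\<lambda>a. a = 0) v = v"
    using assms by (auto simp: strip_cell_def)
  then show "takeWhile (\<lambda>a. a = 0) (replicate i 0 @ v) = replicate i 0"
    and "dropWhile (\<lambda>a. a = 0) (replicate i 0 @ v) = v"
    by (simp_all add: takeWhile_dropWhile_edge)
qed

lemma strip_edge:
  assumes "v \<in> strip_cell k n" "v' \<in> strip_cell k n"
    and eq: "(replicate i 0 @ v) @ [s] = replicate j 0 @ v'"
  shows "(j = i \<and> v' = v @ [s]) \<or> (j = Suc i \<and> v = [] \<and> v' = [])"
proof (cases "v = [] \<and> s = 0")
  case True
  then have "replicate (Suc i) 0 @ [] = replicate j 0 @ v'"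
    using eq by (simp add: replicate_append_same)
  moreover have "[] \<in> strip_cell k n" by (simp add: strip_cell_def)
  ultimately have v': "v' = []" and rep: "replicate (Suc i) (0::nat) = replicate j 0"
    using strip_decomp[of "[]" k n "Suc i"] strip_decomp[OF assms(2), of j] by simp_all
  have "j = Suc i" using arg_cong[OF rep, of length] by (simp only: length_replicate)
  then show ?thesis using True v' by simp
next
  case False
  have nz: "takeWhile (\<lambda>a. a = 0) (v @ [s]) = [] \<and> dropWhile (\<lambda>a. a = 0) (v @ [s]) = v @ [s]"
    using False assms(1) by (auto simp: strip_cell_def)
  have "takeWhile (\<lambda>a. a = 0) (replicate i 0 @ v @ [s]) = replicate i 0"
    "dropWhile (\<lambda>a. a = 0) (replicate i 0 @ v @ [s]) = v @ [s]"
    using nz by (simp_all add: takeWhile_dropWhile_edge)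
  then have v': "v' = v @ [s]" and rep: "replicate i (0::nat) = replicate j 0"
    using strip_decomp[OF assms(2), of j] eq by simp_all
  then show ?thesis using arg_cong[OF rep, of length] v' by simp
qed

lemma strip_shift_eq_labelings:
  "strip_shift k n =
     (\<lambda>x i. restrict (\<lambda>v. x (replicate i 0 @ v)) (strip_cell k n)) ` legal_labelings (strip k n)"
    (is "_ = ?F ` _")
proof (intro equalityI subsetI)
  fix y assume y: "y \<in> strip_shift k n"
  define x where "x = restrict (\<lambda>w. y (length (takeWhile (\<lambda>a. a = 0) w)) (dropWhile (\<lambda>a. a = 0) w))
    (strip k n)"
  have x: "x (replicate i 0 @ v) = y i v" if "v \<in> strip_cell k n" for i v
  proof -
    have "replicate i 0 @ v \<in> strip k n" using that by (auto simp: strip_def)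
    then show ?thesis by (simp add: x_def strip_decomp[OF that])
  qed
  have yl: "y i \<in> legal_labelings (strip_cell k n)" for i using y by (simp add: strip_shift_def)
  have "x \<in> strip k n \<rightarrow>\<^sub>E {0, 1}"
  proof (rule PiE_I)
    fix w assume "w \<in> strip k n"
    then obtain i v where v: "w = replicate i 0 @ v" "v \<in> strip_cell k n" by (auto simp: strip_def)
    then have "y i v \<in> {0, 1}" using yl[of i] PiE_mem unfolding legal_labelings_def by blast
    then show "x w \<in> {0, 1}" using x[OF v(2)] v(1) by simp
  qed (simp add: x_def)
  moreover have "\<not> (x w = 1 \<and> x (w @ [s]) = 1)" if w: "w \<in> strip k n" "w @ [s] \<in> strip k n" for w s
  proof -
    from w obtain i v j v' where v: "w = replicate i 0 @ v" "v \<in> strip_cell k n"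
      "w @ [s] = replicate j 0 @ v'" "v' \<in> strip_cell k n" unfolding strip_def by blast
    have xx: "x w = y i v" "x (w @ [s]) = y j v'"
      using x[OF v(2), of i] x[OF v(4), of j] v(1,3) by simp_all
    have "(j = i \<and> v' = v @ [s]) \<or> (j = Suc i \<and> v = [] \<and> v' = [])"
      using strip_edge[OF v(2,4), of i s j] v(1,3) by simp
    then show ?thesis
    proof
      assume "j = i \<and> v' = v @ [s]"
      then show ?thesis using yl[of i] v xx unfolding legal_labelings_def by auto
    next
      assume "j = Suc i \<and> v = [] \<and> v' = []"
      then show ?thesis using y xx unfolding strip_shift_def by auto
    qed
  qed
  ultimately have "x \<in> legal_labelings (strip k n)" by (simp add: legal_labelings_def)
  moreover have "y = ?F x"
  proof (intro ext)
    fix i v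
    have "y i \<in> strip_cell k n \<rightarrow>\<^sub>E {0, 1}" using yl[of i] by (simp add: legal_labelings_def)
    then have "y i v = undefined" if "v \<notin> strip_cell k n" using that by (rule PiE_arb)
    then show "y i v = ?F x i v" by (simp add: x restrict_def)
  qed
  ultimately show "y \<in> ?F ` legal_labelings (strip k n)" by blast
next
  fix y assume "y \<in> ?F ` legal_labelings (strip k n)"
  then obtain x where x: "x \<in> legal_labelings (strip k n)" and y: "y = ?F x" by blast
  have S: "replicate i 0 @ v \<in> strip k n" if "v \<in> strip_cell k n" for i v
    using that by (auto simp: strip_def)
  have nil: "[] \<in> strip_cell k n" by (simp add: strip_cell_def)
  have legal: "\<not> (x w = 1 \<and> x (w @ [s]) = 1)" if "w \<in> strip k n" "w @ [s] \<in> strip k n" for w s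
    using x that by (auto simp: legal_labelings_def)
  have x01: "x w \<in> {0, 1}" if "w \<in> strip k n" for w
    using x that PiE_mem unfolding legal_labelings_def by blast
  have "y i \<in> legal_labelings (strip_cell k n)" for i
  proof -
    have "y i \<in> strip_cell k n \<rightarrow>\<^sub>E {0, 1}"
    proof (rule PiE_I)
      fix v assume "v \<in> strip_cell k n"
      then show "y i v \<in> {0, 1}" using x01[OF S[of v i]] by (simp add: y)
    qed (simp add: y)
    moreover have "\<not> (y i w = 1 \<and> y i (w @ [s]) = 1)"
      if "w \<in> strip_cell k n" "w @ [s] \<in> strip_cell k n" for w s
      using legal[of "replicate i 0 @ w" s] S[OF that(1), of i] S[OF that(2), of i] that
      by (simp add: y)
    ultimately show ?thesis by (simp add: legal_labelings_def)
  qed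
  moreover have "\<not> (y i [] = 1 \<and> y (Suc i) [] = 1)" for i
    using legal[of "replicate i 0" 0] S[OF nil, of i] S[OF nil, of "Suc i"] nil
    by (simp add: y replicate_append_same)
  ultimately show "y \<in> strip_shift k n" by (simp add: strip_shift_def)
qed

definition strip_entropy :: "nat \<Rightarrow> nat \<Rightarrow> real" where
  "strip_entropy k n = topological_entropy (strip_shift k n) / real (k ^ n)"

end

theory Submission
  imports Defs
begin

text \<open>Let \<open>B n\<close> be the number of legal labelings of \<open>\<Delta>\<^sub>n\<close>. Cutting a tree below its root gives
  \<open>B n ^ k \<le> B (n + 1) \<le> 2 * B n ^ k\<close>, the lower bound counting the labelings with root label 0.
  So \<open>ln (B n) / k ^ n\<close> is increasing and bounded, with a limit \<open>u\<close>, and the tree entropy is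
  \<open>u * (k - 1) / k\<close>. Likewise a strip cell has \<open>a = B (n - 1) ^ (k - 1)\<close> labelings with top label 0
  and at most \<open>2 * a\<close> in all. Symbols with top label 0 may follow each other freely, so the strip
  shift has between \<open>a ^ m\<close> and \<open>(2 * a) ^ m\<close> blocks of length \<open>m\<close>. Hence its entropy is within
  \<open>ln 2\<close> of \<open>(k - 1) * ln (B (n - 1))\<close>, and after division by \<open>k ^ n\<close> the error vanishes.\<close>

subsection \<open>Subadditive sequences and topological entropy\<close>

lemma subadditive_mult_add_le:
  fixes f :: "nat \<Rightarrow> real"
  assumes "\<And>m n. f (m + n) \<le> f m + f n"
  shows "f (q * p + r) \<le> real q * f p + f r"
proof (induction q)
  case (Suc q)
  have "f (Suc q * p + r) \<le> f p + f (q * p + r)"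
    using assms[of p "q * p + r"] by (simp add: add.assoc)
  then show ?case using Suc by (simp add: algebra_simps)
qed simp

text \<open>Fekete's lemma: the limit is the infimum \<open>L\<close> of the quotients. One quotient
  \<open>f p / p\<close> close to \<open>L\<close> controls all large \<open>n\<close>, by division
  of \<open>n\<close> by \<open>p\<close> with remainder.\<close>

lemma fekete_convergent:
  fixes f :: "nat \<Rightarrow> real"
  assumes sub: "\<And>m n. f (m + n) \<le> f m + f n" and nonneg: "\<And>n. 0 \<le> f n"
  shows "convergent (\<lambda>n. f n / real n)"
proof -
  define L where "L = (INF n\<in>{1..}. f n / real n)"
  have bdd: "bdd_below ((\<lambda>n. f n / real n) ` {1..})"
    by (rule bdd_belowI[where m = 0]) (auto simp: nonneg)
  have "(\<lambda>n. f n / real n) \<longlonglongrightarrow> L"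
  proof (rule LIMSEQ_I)
    fix e :: real assume "e > 0"
    then have "L < L + e / 2" by simp
    then obtain p where p: "p \<ge> 1" "f p / real p < L + e / 2"
      unfolding L_def using cINF_less_iff[OF _ bdd] by (metis atLeast_iff empty_iff order_refl)
    \<comment> \<open>Since \<open>f\<close> is nonnegative, the sum \<open>C\<close> bounds
      \<open>f\<close> at every remainder modulo \<open>p\<close>; its share \<open>C / n\<close>
      drops below \<open>e / 2\<close> once \<open>n\<close> exceeds \<open>N\<close>.\<close>
    define C where "C = (\<Sum>r<p. f r)"
    have C: "f r \<le> C" if "r < p" for r
      unfolding C_def using that nonneg by (intro member_le_sum) auto
    obtain N :: nat where N: "N > 2 * C / e" using reals_Archimedean2 by blast
    have "norm (f n / real n - L) < e" if n: "n \<ge> Suc N" for n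
    proof -
      have n0: "real n > 0" using n by simp
      have low: "L \<le> f n / real n" unfolding L_def using n by (intro cINF_lower[OF bdd]) auto
      have "f n \<le> real (n div p) * f p + f (n mod p)"
        using subadditive_mult_add_le[of f, OF sub, of "n div p" p "n mod p"] by simp
      also have "\<dots> \<le> real n / real p * f p + C"
        using p(1) by (intro add_mono mult_right_mono of_nat_div_le_of_nat nonneg C) simp
      finally have "f n / real n \<le> (real n / real p * f p + C) / real n"
        using n0 by (simp add: divide_right_mono)
      also have "\<dots> = f p / real p + C / real n"
        using n0 p(1) by (simp add: field_simps)
      also have "C / real n < e / 2"
      proof -
        have "2 * C / e < real n" using N n by linarith
        then show ?thesis using \<open>e > 0\<close> n0 by (simp add: field_simps)
      qed
      finally show ?thesis using low p(2) by simp
    qed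
    then show "\<exists>no. \<forall>n\<ge>no. norm (f n / real n - L) < e" by blast
  qed
  then show ?thesis by (rule convergentI)
qed

section \<open>Block counts and their exponential growth rate\<close>

lemma blocks_subset_lists:
  assumes "X \<subseteq> UNIV \<rightarrow> A"
  shows "blocks X m \<subseteq> {xs. set xs \<subseteq> A \<and> length xs = m}"
  using assms by (fastforce simp: blocks_def)

lemma finite_blocks:
  assumes "finite A" "X \<subseteq> UNIV \<rightarrow> A"
  shows "finite (blocks X m)"
  using finite_subset[OF blocks_subset_lists[OF assms(2)] finite_lists_length_eq[OF assms(1)]]
  by simp

lemma card_blocks_le:
  assumes "finite A" "X \<subseteq> UNIV \<rightarrow> A"
  shows "card (blocks X m) \<le> card A ^ m"
  using card_mono[OF finite_lists_length_eq[OF assms(1)] blocks_subset_lists[OF assms(2)]]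
  by (simp add: card_lists_length_eq[OF assms(1)])

lemma blocks_nonempty: "X \<noteq> {} \<Longrightarrow> blocks X m \<noteq> {}"
  by (auto simp: blocks_def)

text \<open>Cutting a block after \<open>m\<close> symbols is injective, and both pieces are blocks
  again because \<open>blocks\<close> admits every starting index.\<close>

lemma card_blocks_add_le:
  assumes "finite A" "X \<subseteq> UNIV \<rightarrow> A"
  shows "card (blocks X (m + n)) \<le> card (blocks X m) * card (blocks X n)"
proof -
  have "inj_on (\<lambda>xs. (take m xs, drop m xs)) (blocks X (m + n))"
    by (rule inj_onI) (metis append_take_drop_id prod.inject)
  moreover have "(\<lambda>xs. (take m xs, drop m xs)) ` blocks X (m + n) \<subseteq> blocks X m \<times> blocks X n"
  proof clarsimp
    fix xs assume "xs \<in> blocks X (m + n)"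
    then obtain x i where x: "x \<in> X" "xs = map x [i..<i + (m + n)]" by (auto simp: blocks_def)
    have "take m xs = map x [i..<i + m]" by (simp add: x take_map)
    moreover have "drop m xs = map x [i + m..<i + m + n]" by (simp add: x drop_map add.assoc)
    ultimately show "take m xs \<in> blocks X m \<and> drop m xs \<in> blocks X n"
      using x(1) unfolding blocks_def by blast
  qed
  ultimately have "card (blocks X (m + n)) \<le> card (blocks X m \<times> blocks X n)"
    by (intro card_inj_on_le finite_cartesian_product finite_blocks[OF assms]) auto
  then show ?thesis by (simp add: card_cartesian_product)
qed

lemma ln_of_nat_mono: "0 < m \<Longrightarrow> m \<le> n \<Longrightarrow> ln (real m) \<le> ln (real n)"
  by (rule ln_mono) (simp_all only: of_nat_le_iff of_nat_0_less_iff)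

text \<open>The definition by \<open>lim\<close> says something only once convergence is known. The
  logarithms of the block counts are subadditive, so Fekete's lemma supplies it.\<close>

lemma topological_entropy_LIMSEQ:
  assumes "finite A" "X \<subseteq> UNIV \<rightarrow> A" "X \<noteq> {}"
  shows "(\<lambda>m. ln (real (card (blocks X m))) / real m) \<longlonglongrightarrow> topological_entropy X"
proof -
  have pos: "card (blocks X m) \<ge> 1" for m
    using finite_blocks[OF assms(1,2)] blocks_nonempty[OF assms(3)]
    by (simp add: Suc_le_eq card_gt_0_iff)
  have "ln (real (card (blocks X (m + n))))
      \<le> ln (real (card (blocks X m))) + ln (real (card (blocks X n)))" for m n
  proof -
    have "ln (real (card (blocks X (m + n)))) \<le> ln (real (card (blocks X m) * card (blocks X n)))"
      using card_blocks_add_le[OF assms(1,2)] pos[of "m + n"] by (intro ln_of_nat_mono) auto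
    then show ?thesis using pos[of m] pos[of n] by (simp add: ln_mult)
  qed
  then have "convergent (\<lambda>m. ln (real (card (blocks X m))) / real m)"
    using pos by (intro fekete_convergent) auto
  then show ?thesis by (simp add: topological_entropy_def convergent_LIMSEQ_iff)
qed

lemma topological_entropy_bounds:
  fixes a b :: real
  assumes "finite A" "X \<subseteq> UNIV \<rightarrow> A" "X \<noteq> {}" and "a > 0"
    and low: "\<And>m. a ^ m \<le> real (card (blocks X m))"
    and up: "\<And>m. real (card (blocks X m)) \<le> b ^ m"
  shows "ln a \<le> topological_entropy X" and "topological_entropy X \<le> ln b"
proof -
  note lim = topological_entropy_LIMSEQ[OF assms(1-3)]
  \<comment> \<open>The case \<open>m = 1\<close> places a block count between \<open>a\<close> and
    \<open>b\<close>.\<close>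
  have b: "b > 0" using low[of 1] up[of 1] \<open>a > 0\<close> by simp
  have "ln a \<le> ln (real (card (blocks X m))) / real m \<and>
      ln (real (card (blocks X m))) / real m \<le> ln b" if m: "m \<ge> 1" for m
  proof -
    have am: "0 < a ^ m" using \<open>a > 0\<close> by simp
    have "ln (a ^ m) \<le> ln (real (card (blocks X m)))" using low[of m] am by (intro ln_mono) auto
    moreover have "ln (real (card (blocks X m))) \<le> ln (b ^ m)"
      using up[of m] low[of m] am by (intro ln_mono) linarith+
    ultimately show ?thesis using m \<open>a > 0\<close> b by (simp add: ln_realpow field_simps)
  qed
  then show "ln a \<le> topological_entropy X" "topological_entropy X \<le> ln b"
    using LIMSEQ_le_const[OF lim] LIMSEQ_le_const2[OF lim] by blast+
qed

subsection \<open>Labelings of a root with branches\<close>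

text \<open>The common shape of \<Delta> one level deeper (\<open>S = {..<k}\<close>) and of a strip
  cell (\<open>S = {1..<k}\<close>), so that one count serves both. Words are split at the first
  letter here, whereas a child is formed by appending a last letter.\<close>

definition graft :: "nat set \<Rightarrow> nat list set \<Rightarrow> nat list set" where
  "graft S D = insert [] {s # w | s w. s \<in> S \<and> w \<in> D}"

text \<open>Both restrictions make the result extensional, hence an element of a product
  \<open>S \<rightarrow>\<^sub>E legal_labelings D\<close> whose cardinality is a power.\<close>

definition branches :: "nat set \<Rightarrow> nat list set \<Rightarrow> (nat list \<Rightarrow> nat) \<Rightarrow> nat \<Rightarrow> nat list \<Rightarrow> nat" where
  "branches S D x = (\<lambda>s\<in>S. \<lambda>w\<in>D. x (s # w))"

lemma graft_simps [simp]: "[] \<in> graft S D" "s # w \<in> graft S D \<longleftrightarrow> s \<in> S \<and> w \<in> D"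
  by (auto simp: graft_def)

lemma finite_graft: "finite S \<Longrightarrow> finite D \<Longrightarrow> finite (graft S D)"
  unfolding graft_def by (simp add: finite_image_set2)

lemma finite_legal_labelings: "finite S \<Longrightarrow> finite (legal_labelings S)"
  unfolding legal_labelings_def by (rule finite_subset[of _ "S \<rightarrow>\<^sub>E {0, 1}"]) (auto intro: finite_PiE)

lemma legal_labelings_zero: "(\<lambda>w\<in>S. 0) \<in> legal_labelings S"
  by (auto simp: legal_labelings_def)

lemma card_legal_labelings_pos: "finite S \<Longrightarrow> 0 < card (legal_labelings S)"
  using legal_labelings_zero finite_legal_labelings by (metis card_gt_0_iff empty_iff)

text \<open>Prefixing a letter of \<open>S\<close> turns each edge of \<open>D\<close> into an edge
  of the graft.\<close>

lemma branches_in: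
  assumes "x \<in> legal_labelings (graft S D)"
  shows "branches S D x \<in> S \<rightarrow>\<^sub>E legal_labelings D"
proof -
  have x01: "x v \<in> {0, 1}" if "v \<in> graft S D" for v
    using assms that PiE_mem unfolding legal_labelings_def by blast
  have leg: "\<not> (x w = 1 \<and> x (w @ [s]) = 1)" if "w \<in> graft S D" "w @ [s] \<in> graft S D" for w s
    using assms that unfolding legal_labelings_def by blast
  show ?thesis
    using x01 leg[of "_ # _"] by (auto simp: branches_def legal_labelings_def)
qed

text \<open>Every node other than the root lies in a branch, and outside the graft extensionality
  fixes the value.\<close>

lemma inj_on_root_branches:
  "inj_on (\<lambda>x. (x [], branches S D x)) (legal_labelings (graft S D))"
proof (rule inj_onI)
  fix x y
  assume x: "x \<in> legal_labelings (graft S D)" and y: "y \<in> legal_labelings (graft S D)"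
    and eq: "(x [], branches S D x) = (y [], branches S D y)"
  have "x v = y v" if "v \<in> graft S D" for v
  proof (cases v)
    case (Cons s w)
    then have "branches S D x s w = x v" "branches S D y s w = y v"
      using that by (simp_all add: branches_def)
    then show ?thesis using eq by simp
  qed (use eq in simp)
  moreover have "x v = y v" if "v \<notin> graft S D" for v
    using x y that by (auto simp: legal_labelings_def PiE_def extensional_def)
  ultimately show "x = y" by blast
qed

text \<open>A root labeled 0 puts no condition on its children, so the branches can be chosen
  independently of each other.\<close>

lemma bij_betw_branches:
  "bij_betw (branches S D) {x \<in> legal_labelings (graft S D). x [] = 0} (S \<rightarrow>\<^sub>E legal_labelings D)"
proof (rule bij_betwI')
  fix x y
  assume "x \<in> {x \<in> legal_labelings (graft S D). x [] = 0}"
    "y \<in> {x \<in> legal_labelings (graft S D). x [] = 0}"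
  then show "(branches S D x = branches S D y) = (x = y)"
    using inj_onD[OF inj_on_root_branches, of x S D y] by auto
next
  fix g assume g: "g \<in> S \<rightarrow>\<^sub>E legal_labelings D"
  \<comment> \<open>The preimage of \<open>g\<close>: the given branches hung below a root labeled
    0. Edges at the root are legal by that label, all others by legality of the
    \<open>g s\<close>.\<close>
  define x where "x = (\<lambda>v\<in>graft S D. case v of [] \<Rightarrow> 0 | s # w \<Rightarrow> g s w)"
  have gl: "g s \<in> legal_labelings D" if "s \<in> S" for s using g that by auto
  have g01: "g s w \<in> {0, 1}" if "s \<in> S" "w \<in> D" for s w
    using gl[OF that(1)] that(2) PiE_mem unfolding legal_labelings_def by blast
  have xc: "x (s # w) = g s w" if "s \<in> S" "w \<in> D" for s w
    using that by (simp add: x_def)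
  have "x \<in> graft S D \<rightarrow>\<^sub>E {0, 1}"
    using g01 by (auto simp: x_def split: list.split)
  moreover have "\<not> (x v = 1 \<and> x (v @ [t]) = 1)" if "v \<in> graft S D" "v @ [t] \<in> graft S D" for v t
  proof (cases v)
    case (Cons s w)
    then have "s \<in> S" "w \<in> D" "w @ [t] \<in> D" using that by simp_all
    then show ?thesis using gl[of s] Cons by (simp add: xc legal_labelings_def)
  qed (simp add: x_def)
  ultimately have "x \<in> legal_labelings (graft S D)" by (simp add: legal_labelings_def)
  moreover have "x [] = 0" by (simp add: x_def)
  moreover have "g = branches S D x"
  proof (intro ext)
    fix s w
    show "g s w = branches S D x s w"
    proof (cases "s \<in> S")
      case True
      then show ?thesis using gl[OF True] xc[OF True]
        by (auto simp: branches_def legal_labelings_def PiE_def extensional_def restrict_def)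
    next
      case False
      then show ?thesis using PiE_arb[OF g False] by (simp add: branches_def)
    qed
  qed
  ultimately show "\<exists>x\<in>{x \<in> legal_labelings (graft S D). x [] = 0}. g = branches S D x" by blast
qed (use branches_in in blast)

lemma card_root_zero_labelings:
  "finite S \<Longrightarrow>
    card {x \<in> legal_labelings (graft S D). x [] = 0} = card (legal_labelings D) ^ card S"
  by (simp add: bij_betw_same_card[OF bij_betw_branches] card_PiE)

lemma card_legal_labelings_graft_ge:
  assumes "finite S" "finite D"
  shows "card (legal_labelings D) ^ card S \<le> card (legal_labelings (graft S D))"
  using assms
  by (auto simp flip: card_root_zero_labelings intro!: card_mono finite_legal_labelings finite_graft)

text \<open>The factor 2 accounts for the root label; conflicts between a root labeled 1 and its
  children are ignored.\<close>

lemma card_legal_labelings_graft_le: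
  assumes "finite S" "finite D"
  shows "card (legal_labelings (graft S D)) \<le> 2 * card (legal_labelings D) ^ card S"
proof -
  have "(\<lambda>x. (x [], branches S D x)) ` legal_labelings (graft S D)
      \<subseteq> {0, 1} \<times> (S \<rightarrow>\<^sub>E legal_labelings D)"
  proof (rule image_subsetI)
    fix x assume x: "x \<in> legal_labelings (graft S D)"
    then have "x [] \<in> {0, 1}" unfolding legal_labelings_def by (auto dest: PiE_mem[of _ _ _ "[]"])
    then show "(x [], branches S D x) \<in> {0, 1} \<times> (S \<rightarrow>\<^sub>E legal_labelings D)"
      using branches_in[OF x] by simp
  qed
  then have "card (legal_labelings (graft S D))
      \<le> card ({0::nat, 1} \<times> (S \<rightarrow>\<^sub>E legal_labelings D))"
    using assms by (intro card_inj_on_le[OF inj_on_root_branches])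
      (auto intro!: finite_PiE finite_legal_labelings)
  then show ?thesis using assms by (simp add: card_cartesian_product card_PiE)
qed

subsection \<open>The two entropies\<close>

lemma Delta_Suc: "Delta k (int (Suc n)) = graft {..<k} (Delta k (int n))"
proof -
  have "v \<in> Delta k (int (Suc n)) \<longleftrightarrow> v \<in> graft {..<k} (Delta k (int n))" for v
    by (cases v) (auto simp: Delta_def tree_def)
  then show ?thesis by blast
qed

lemma Delta_0: "Delta k 0 = {[]}"
  by (auto simp: Delta_def tree_def)

lemma finite_Delta: "finite (Delta k (int n))"
proof (induction n)
  case (Suc n)
  then show ?case unfolding Delta_Suc by (intro finite_graft) simp_all
qed (simp add: Delta_0)

lemma card_graft:
  assumes "finite S" "finite D"
  shows "card (graft S D) = Suc (card S * card D)"
proof -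
  have "graft S D = insert [] ((\<lambda>(s, w). s # w) ` (S \<times> D))" by (auto simp: graft_def)
  moreover have "inj_on (\<lambda>(s, w). s # w) (S \<times> D)" by (auto intro!: inj_onI)
  ultimately show ?thesis
    using assms by (auto simp: card_image card_cartesian_product card_insert_if)
qed

text \<open>A geometric sum, cleared of its denominator and stated over the reals to avoid truncated
  subtraction.\<close>

lemma card_Delta: "(real k - 1) * real (card (Delta k (int n))) = real k ^ Suc n - 1"
proof (induction n)
  case (Suc n)
  have "card (Delta k (int (Suc n))) = Suc (k * card (Delta k (int n)))"
    unfolding Delta_Suc by (simp add: card_graft finite_Delta)
  then show ?case using Suc by (simp add: algebra_simps)
qed (simp add: Delta_0)

lemma strip_cell_Suc: "strip_cell k (Suc n) = graft {1..<k} (Delta k (int n))"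
  by (simp add: strip_cell_def graft_def)

section \<open>Growth of the number of legal labelings of \<Delta>\<close>

abbreviation tree_count :: "nat \<Rightarrow> nat \<Rightarrow> nat" where
  "tree_count k n \<equiv> card (legal_labelings (Delta k (int n)))"

lemma tree_count_pos: "0 < tree_count k n"
  by (rule card_legal_labelings_pos[OF finite_Delta])

lemma tree_count_Suc_bounds:
  "tree_count k n ^ k \<le> tree_count k (Suc n)" "tree_count k (Suc n) \<le> 2 * tree_count k n ^ k"
  unfolding Delta_Suc
  using card_legal_labelings_graft_ge[OF finite_lessThan[of k] finite_Delta[of k n]]
    card_legal_labelings_graft_le[OF finite_lessThan[of k] finite_Delta[of k n]] by simp_all

lemma convergent_ln_tree_count:
  assumes "k \<ge> 2"
  shows "convergent (\<lambda>n. ln (real (tree_count k n)) / real k ^ n)"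
proof -
  let ?u = "\<lambda>n. ln (real (tree_count k n)) / real k ^ n"
  have kn: "real k ^ n > 0" for n using assms by simp
  \<comment> \<open>Logarithms of \<open>tree_count_Suc_bounds\<close>, divided by
    \<open>real k ^ Suc n\<close>.\<close>
  have step: "?u n \<le> ?u (Suc n) \<and> ?u (Suc n) \<le> ?u n + ln 2 / real k ^ Suc n" for n
  proof -
    have lnk: "ln (real (tree_count k n ^ k)) = real k * ln (real (tree_count k n))"
      using tree_count_pos[of k n] by (simp add: ln_realpow)
    have "ln (real (tree_count k n ^ k)) \<le> ln (real (tree_count k (Suc n)))"
      using tree_count_Suc_bounds(1) tree_count_pos[of k n] by (intro ln_of_nat_mono) simp_all
    moreover have "ln (real (tree_count k (Suc n))) \<le> ln (real (2 * tree_count k n ^ k))"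
      by (intro ln_of_nat_mono tree_count_pos tree_count_Suc_bounds(2))
    moreover have "ln (real (2 * tree_count k n ^ k)) = ln 2 + ln (real (tree_count k n ^ k))"
      using tree_count_pos[of k n] by (simp add: ln_mult)
    ultimately have b: "real k * ln (real (tree_count k n)) \<le> ln (real (tree_count k (Suc n)))"
      "ln (real (tree_count k (Suc n))) \<le> ln 2 + real k * ln (real (tree_count k n))"
      unfolding lnk by linarith+
    have u: "?u n = real k * ln (real (tree_count k n)) / real k ^ Suc n" using assms by simp
    show ?thesis unfolding u add_divide_distrib[symmetric]
      using b kn[of "Suc n"] by (intro conjI divide_right_mono) (auto simp: add.commute)
  qed
  \<comment> \<open>The increments add up to at most \<open>ln 2\<close> times the sum of
    \<open>1 / real k ^ i\<close> for \<open>i\<close> from 1 to \<open>n\<close>. The term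
    \<open>1 - 1 / real k ^ n\<close> dominates that sum and telescopes in the induction.\<close>
  have bound: "?u n \<le> ?u 0 + ln 2 * (1 - 1 / real k ^ n)" for n
  proof (induction n)
    case (Suc n)
    \<comment> \<open>After clearing denominators this is \<open>2 \<le> k\<close>.\<close>
    have "1 / real k ^ Suc n \<le> 1 / real k ^ n - 1 / real k ^ Suc n"
      using assms kn[of n] by (simp add: field_simps)
    then have "ln 2 * (1 / real k ^ Suc n) \<le> ln 2 * (1 / real k ^ n - 1 / real k ^ Suc n)"
      by (intro mult_left_mono) auto
    then have "ln 2 / real k ^ Suc n \<le> ln 2 * (1 / real k ^ n) - ln 2 * (1 / real k ^ Suc n)"
      by (simp only: right_diff_distrib times_divide_eq_right mult_1_right)
    then show ?case using Suc step[of n] unfolding right_diff_distrib by linarith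
  qed simp
  have "?u n \<le> ?u 0 + ln 2" for n
  proof -
    have "ln 2 * (1 - 1 / real k ^ n) \<le> ln 2 * (1::real)" using kn by (intro mult_left_mono) auto
    then show ?thesis using bound[of n] by linarith
  qed
  then have "\<bar>?u n\<bar> \<le> ?u 0 + ln 2" for n
    using tree_count_pos[of k n] kn[of n] by (simp add: Suc_le_eq)
  then have "Bseq ?u" by (intro BseqI'[where K = "?u 0 + ln 2"]) simp
  moreover have "incseq ?u" using step by (intro incseq_SucI) blast
  ultimately show ?thesis by (intro Bseq_mono_convergent) (auto dest: incseqD)
qed

text \<open>By \<open>card_Delta\<close>, the size of \<Delta> is
  \<open>real k ^ n * (real k - inverse (real k) ^ n) / (real k - 1)\<close>, and the inverse power
  tends to 0.\<close>

lemma tree_entropy_eq: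
  assumes k: "k \<ge> 2" and u: "(\<lambda>n. ln (real (tree_count k n)) / real k ^ n) \<longlonglongrightarrow> u"
  shows "tree_entropy k = u * (real k - 1) / real k"
proof -
  have "(\<lambda>n. (ln (real (tree_count k n)) / real k ^ n) * (real k - 1)
      / (real k - inverse (real k) ^ n)) \<longlonglongrightarrow> u * (real k - 1) / (real k - 0)"
    using k by (intro tendsto_intros u LIMSEQ_realpow_zero) (auto simp: inverse_eq_divide)
  moreover have "(ln (real (tree_count k n)) / real k ^ n) * (real k - 1)
      / (real k - inverse (real k) ^ n)
      = ln (real (tree_count k n)) / real (card (Delta k (int n)))" for n
  proof -
    have "real k ^ n * (real k - inverse (real k) ^ n) = real k ^ Suc n - 1"
      using k by (simp add: power_inverse right_diff_distrib)
    then have "real k ^ n * (real k - inverse (real k) ^ n)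
        = (real k - 1) * real (card (Delta k (int n)))" using card_Delta[of k n] by simp
    moreover have "(ln (real (tree_count k n)) / real k ^ n) * (real k - 1)
        / (real k - inverse (real k) ^ n) = ln (real (tree_count k n)) * (real k - 1)
        / (real k ^ n * (real k - inverse (real k) ^ n))" by simp
    ultimately show ?thesis using k by simp
  qed
  ultimately show ?thesis unfolding tree_entropy_def by (intro limI) simp
qed

section \<open>Strip entropy in terms of tree counts\<close>

lemma strip_entropy_Suc_bounds:
  assumes k: "k \<ge> 2"
  defines "c n \<equiv> (real k - 1) * ln (real (tree_count k n))"
  shows "c n / real k ^ Suc n \<le> strip_entropy k (Suc n)"
    and "strip_entropy k (Suc n) \<le> (c n + ln 2) / real k ^ Suc n"
proof -
  define X where "X = strip_shift k (Suc n)"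
  define A where "A = legal_labelings (strip_cell k (Suc n))"
  define Z where "Z = {x \<in> A. x [] = 0}"
  \<comment> \<open>The number of symbols with top label 0: one labeling of \<Delta> for each of the
    \<open>k - 1\<close> branches. Its logarithm is \<open>c n\<close>.\<close>
  define a where "a = tree_count k n ^ (k - 1)"
  have finA: "finite A"
    unfolding A_def strip_cell_Suc by (intro finite_legal_labelings finite_graft finite_Delta) simp
  have XA: "X \<subseteq> UNIV \<rightarrow> A" by (auto simp: X_def strip_shift_def A_def)
  have cZ: "card Z = a"
    by (simp add: Z_def A_def a_def strip_cell_Suc card_root_zero_labelings)
  have cA: "card A \<le> 2 * a"
    using card_legal_labelings_graft_le[of "{1..<k}" "Delta k (int n)"]
    by (simp add: A_def a_def strip_cell_Suc finite_Delta)
  have apos: "a > 0" using tree_count_pos by (simp add: a_def)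
  have finZ: "finite Z" using finA by (simp add: Z_def)
  obtain z where z: "z \<in> Z" using cZ apos by fastforce
  \<comment> \<open>Only two consecutive top labels 1 are forbidden, so every sequence over
    \<open>Z\<close> belongs to the shift.\<close>
  have ZX: "x \<in> X" if "\<And>i. x i \<in> Z" for x
    using that by (auto simp: X_def strip_shift_def Z_def A_def)
  have Xne: "X \<noteq> {}" using ZX[of "\<lambda>_. z"] z by blast
  have "a ^ m \<le> card (blocks X m)" for m
  proof -
    have "{xs. set xs \<subseteq> Z \<and> length xs = m} \<subseteq> blocks X m"
    proof clarify
      fix xs assume xs: "set xs \<subseteq> Z" "m = length xs"
      \<comment> \<open>Padding with the constant \<open>z\<close> extends any word over
        \<open>Z\<close> to a point of \<open>X\<close>, in which it is the block starting at
        0.\<close>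
      define x where "x i = (if i < length xs then xs ! i else z)" for i
      have "x \<in> X" using xs z by (intro ZX) (auto simp: x_def)
      moreover have "xs = map x [0..<0 + length xs]" by (intro nth_equalityI) (auto simp: x_def)
      ultimately show "xs \<in> blocks X (length xs)" unfolding blocks_def by blast
    qed
    from card_mono[OF finite_blocks[OF finA XA] this] show ?thesis
      by (simp add: card_lists_length_eq[OF finZ] cZ)
  qed
  then have low: "real a ^ m \<le> real (card (blocks X m))" for m
    by (metis of_nat_le_iff of_nat_power)
  have "card (blocks X m) \<le> (2 * a) ^ m" for m
    using card_blocks_le[OF finA XA, of m] power_mono[OF cA, of m] by simp
  then have up: "real (card (blocks X m)) \<le> (2 * real a) ^ m" for m
    by (metis of_nat_le_iff of_nat_power of_nat_mult of_nat_numeral)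
  have lna: "ln (real a) = c n"
    using k tree_count_pos by (simp add: a_def c_def ln_realpow of_nat_diff)
  have "c n \<le> topological_entropy X" "topological_entropy X \<le> c n + ln 2"
    using topological_entropy_bounds[OF finA XA Xne _ low up] apos lna
    by (simp_all add: ln_mult)
  then show "c n / real k ^ Suc n \<le> strip_entropy k (Suc n)"
    "strip_entropy k (Suc n) \<le> (c n + ln 2) / real k ^ Suc n"
    unfolding strip_entropy_def X_def of_nat_power by (intro divide_right_mono; simp)+
qed

theorem theorem3p1:
  fixes k :: nat
  assumes "k \<ge> 2"
  shows "(\<lambda>n. strip_entropy k n) \<longlonglongrightarrow> tree_entropy k"
proof -
  let ?v = "\<lambda>n. ln (real (tree_count k n)) / real k ^ n"
  obtain u where u: "?v \<longlonglongrightarrow> u"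
    using convergent_ln_tree_count[OF assms] by (auto simp: convergent_def)
  have h: "tree_entropy k = u * (real k - 1) / real k" by (rule tree_entropy_eq[OF assms u])
  \<comment> \<open>The added term is the gap \<open>ln 2 / real k ^ Suc n\<close> between the two
    strip bounds, written with an inverse power so that its limit 0 is immediate.\<close>
  have err: "(\<lambda>n. ?v n * (real k - 1) / real k + ln 2 * inverse (real k) ^ n / real k)
      \<longlonglongrightarrow> u * (real k - 1) / real k + ln 2 * 0 / real k"
    using assms by (intro tendsto_intros u LIMSEQ_realpow_zero) (auto simp: inverse_eq_divide)
  have main: "(\<lambda>n. ?v n * (real k - 1) / real k) \<longlonglongrightarrow> u * (real k - 1) / real k"
    using assms by (intro tendsto_intros u) auto
  \<comment> \<open>The shifted index matches the bounds: a cell of index \<open>Suc n\<close>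
    carries copies of \<open>Delta k (int n)\<close>. The limit of the sequence is unchanged by the
    shift.\<close>
  have "(\<lambda>n. strip_entropy k (Suc n)) \<longlonglongrightarrow> tree_entropy k"
    unfolding h
  proof (rule tendsto_sandwich[OF _ _ main])
    show "\<forall>\<^sub>F n in sequentially. ?v n * (real k - 1) / real k \<le> strip_entropy k (Suc n)"
      using strip_entropy_Suc_bounds(1)[OF assms] by (simp add: ac_simps)
    show "\<forall>\<^sub>F n in sequentially. strip_entropy k (Suc n)
        \<le> ?v n * (real k - 1) / real k + ln 2 * inverse (real k) ^ n / real k"
    proof (rule always_eventually, rule allI)
      fix n
      have "((real k - 1) * ln (real (tree_count k n)) + ln 2) / real k ^ Suc n
          = ?v n * (real k - 1) / real k + ln 2 * inverse (real k) ^ n / real k"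
        by (simp add: divide_inverse power_inverse algebra_simps)
      then show "strip_entropy k (Suc n)
          \<le> ?v n * (real k - 1) / real k + ln 2 * inverse (real k) ^ n / real k"
        using strip_entropy_Suc_bounds(2)[OF assms, of n] by simp
    qed
    show "(\<lambda>n. ?v n * (real k - 1) / real k + ln 2 * inverse (real k) ^ n / real k)
        \<longlonglongrightarrow> u * (real k - 1) / real k"
      using err by simp
  qed
  then show ?thesis by (simp only: filterlim_sequentially_Suc)
qed

end
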